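(* Let $G_1,\ldots,G_k$ be a collection of graphs, all on the same vertex set $V$, and let $a_1,\ldots,a_k$ and $r_1,\ldots,r_k$ be positive integers. Set $A=a_1+\cdots+a_k$. Then there exists an ordering $\sigma^*$ of the common vertex set $V$ such that for all $i=1,\ldots,k$ we have \[\operatorname{scol}_{r_i}(G_i,\sigma^* )\le\frac{A}{a_i}\bigl(\operatorname{wcol}_{2r_i}(G_i)\bigr)^2+\operatorname{wcol}_{2r_i}(G_i).\]
   Context: All graphs $G=(V,E)$ are finite, simple and undirected. An ordering $\sigma$ of $G$ is a total ordering $<_\sigma$ of its vertex set $V$; $\Pi(G)$ denotes the set of all orderings of $G$. Let $r$ be a positive integer, $\sigma\in\Pi(G)$ and $x\in V$. A vertex $y$ is weakly $r$-reachable from $x$ with respect to $\sigma$ if $y\le_\sigma x$ and there is a path $P$ in $G$ from $x$ to $y$ with at most $r$ edges such that every vertex $p\in V(P)$ satisfies $p\ge_\sigma y$; $y$ is strongly $r$-reachable from $x$ if $y\le_\sigma x$ and there is such a path $P$ with at most $r$ edges for which every $p\in V(P)\setminus\{y\}$ satisfies the stronger condition $p\ge_\sigma x$. Let $W_r[G,\sigma,x]$ and $S_r[G,\sigma,x]$ be the sets of vertices weakly, respectively strongly, $r$-reachable from $x$ (both contain $x$). Define $\operatorname{wcol}_r(G,\sigma)=\max_{x\in V}|W_r[G,\sigma,x]|$, $\operatorname{wcol}_r(G)=\min_{\sigma\in\Pi(G)}\operatorname{wcol}_r(G,\sigma)$, and $\operatorname{scol}_r(G,\sigma)=\max_{x\in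 V}|S_r[G,\sigma,x]|$. *)

theory Defs
  imports Complex_Main "Graph_Theory.Pair_Digraph" "Graph_Theory.Vertex_Walk"
begin

text \<open>
  A finite simple undirected graph is a \<open>pair_graph\<close>: a finite, loopless digraph without
  parallel arcs whose arc relation is symmetric, an edge \<open>{u, v}\<close> being the two
  arcs \<open>(u, v)\<close> and \<open>(v, u)\<close>.

  An ordering \<open>\<sigma>\<close> of a graph is a relation with \<open>linear_order_on (pverts G) \<sigma>\<close>, and
  \<open>(u, v) \<in> \<sigma>\<close> means that \<open>u\<close> is at most \<open>v\<close>.
\<close>

definition path_between :: "'a pair_pre_digraph \<Rightarrow> 'a \<Rightarrow> 'a vwalk \<Rightarrow> 'a \<Rightarrow> bool" where
  "path_between G x P y \<longleftrightarrow> vpath P (with_proj G) \<and> hd P = x \<and> last P = y"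

definition weakly_reachable :: "nat \<Rightarrow> 'a pair_pre_digraph \<Rightarrow> 'a rel \<Rightarrow> 'a \<Rightarrow> 'a \<Rightarrow> bool" where
  "weakly_reachable r G \<sigma> x y \<longleftrightarrow>
     (y, x) \<in> \<sigma> \<and>
     (\<exists>P. path_between G x P y \<and> vwalk_length P \<le> r \<and> (\<forall>p\<in>set P. (y, p) \<in> \<sigma>))"

definition strongly_reachable :: "nat \<Rightarrow> 'a pair_pre_digraph \<Rightarrow> 'a rel \<Rightarrow> 'a \<Rightarrow> 'a \<Rightarrow> bool" where
  "strongly_reachable r G \<sigma> x y \<longleftrightarrow>
     (y, x) \<in> \<sigma> \<and>
     (\<exists>P. path_between G x P y \<and> vwalk_length P \<le> r \<and> (\<forall>p\<in>set P - {y}. (x, p) \<in> \<sigma>))"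

definition W_set :: "nat \<Rightarrow> 'a pair_pre_digraph \<Rightarrow> 'a rel \<Rightarrow> 'a \<Rightarrow> 'a set" where
  "W_set r G \<sigma> x = {y \<in> pverts G. weakly_reachable r G \<sigma> x y}"

definition S_set :: "nat \<Rightarrow> 'a pair_pre_digraph \<Rightarrow> 'a rel \<Rightarrow> 'a \<Rightarrow> 'a set" where
  "S_set r G \<sigma> x = {y \<in> pverts G. strongly_reachable r G \<sigma> x y}"

text \<open>
  On \<^typ>\<open>nat\<close> the supremum of a finite nonempty set is its maximum and \<open>Sup {} = 0\<close>, so the
  graph without vertices gets the value \<open>0\<close>, where \<^const>\<open>Max\<close> would be unspecified.
\<close>

definition wcol_ord :: "nat \<Rightarrow> 'a pair_pre_digraph \<Rightarrow> 'a rel \<Rightarrow> nat" where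
  "wcol_ord r G \<sigma> = (SUP x\<in>pverts G. card (W_set r G \<sigma> x))"

definition scol_ord :: "nat \<Rightarrow> 'a pair_pre_digraph \<Rightarrow> 'a rel \<Rightarrow> nat" where
  "scol_ord r G \<sigma> = (SUP x\<in>pverts G. card (S_set r G \<sigma> x))"

definition wcol :: "nat \<Rightarrow> 'a pair_pre_digraph \<Rightarrow> nat" where
  "wcol r G = (MIN \<sigma>\<in>{\<sigma>. linear_order_on (pverts G) \<sigma>}. wcol_ord r G \<sigma>)"

end

theory Submission
  imports Defs
begin

text \<open>
  Let \<open>c\<^sub>i\<close> be the weak colouring number of \<open>G\<^sub>i\<close>, attained by the ordering \<open>\<sigma>\<^sub>i\<close>. The ordering
  \<open>\<sigma>\<close> is built from its largest vertex downwards. If \<open>U\<close> is the set of vertices not yet placed, then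
  each \<open>y \<in> U\<close> weakly reaches at most \<open>c\<^sub>i\<close> vertices \<open>m \<in> U\<close>, so some \<open>m \<in> U\<close> is weakly reached
  with respect to \<open>\<sigma>\<^sub>i\<close> from at most \<open>(A / a\<^sub>i) c\<^sub>i\<close> vertices of \<open>U\<close>, for all \<open>i\<close> at once: average the sum
  over \<open>i\<close> of these numbers with weights \<open>a\<^sub>i / c\<^sub>i\<close>. Place this \<open>m\<close> next.

  If \<open>y\<close> is strongly reachable from \<open>x\<close> with respect to \<open>\<sigma>\<close> along a path \<open>P\<close>, let \<open>m\<close> be the
  \<open>\<sigma>\<^sub>i\<close>-least vertex of \<open>P\<close>. It is weakly reachable from both \<open>x\<close> and \<open>y\<close> with respect to \<open>\<sigma>\<^sub>i\<close>, and
  either \<open>y = m\<close> or \<open>y \<le> x \<le> m\<close> in \<open>\<sigma>\<close>. There are at most \<open>c\<^sub>i\<close> choices of \<open>m\<close>, and in the second case at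
  most \<open>(A / a\<^sub>i) c\<^sub>i\<close> choices of \<open>y\<close> for each of them.
\<close>

section \<open>Averaging over the vertices\<close>

lemma ex_le_of_sum_le:
  fixes f :: "'a \<Rightarrow> real" and C :: real
  assumes "finite V" "V \<noteq> {}" "(\<Sum>m\<in>V. f m) \<le> C * card V"
  shows "\<exists>m\<in>V. f m \<le> C"
proof (rule ccontr)
  assume "\<not> ?thesis"
  then have "(\<Sum>m\<in>V. C) < (\<Sum>m\<in>V. f m)"
    using assms(1,2) by (intro sum_strict_mono) (auto simp: not_le)
  with assms(3) show False by (simp add: mult.commute)
qed

text \<open>Double counting the related pairs bounds the sum over \<open>m\<close> of
  \<open>card {y \<in> V. R i y m}\<close> by \<open>c i * card V\<close>. The weight
  \<open>a i / c i\<close> turns this into \<open>a i * card V\<close>, so some \<open>m\<close> has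
  weighted total at most \<open>sum a I\<close>. The terms of that total are nonnegative, so each of
  them obeys the same bound, and dividing by its weight gives the claim.\<close>

lemma ex_uniformly_rarely_related:
  fixes R :: "'i \<Rightarrow> 'a \<Rightarrow> 'a \<Rightarrow> bool" and a c :: "'i \<Rightarrow> real"
  assumes "finite I" "finite V" "V \<noteq> {}"
    and pos: "\<And>i. i \<in> I \<Longrightarrow> a i > 0" "\<And>i. i \<in> I \<Longrightarrow> c i > 0"
    and few: "\<And>i y. i \<in> I \<Longrightarrow> y \<in> V \<Longrightarrow> card {m \<in> V. R i y m} \<le> c i"
  shows "\<exists>m\<in>V. \<forall>i\<in>I. card {y \<in> V. R i y m} \<le> sum a I / a i * c i"
proof -
  have swap: "(\<Sum>m\<in>V. card {y \<in> V. R i y m}) = (\<Sum>y\<in>V. card {m \<in> V. R i y m})" for i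
    by (intro sum_multicount_gen) (use \<open>finite V\<close> in auto)
  have "(\<Sum>m\<in>V. \<Sum>i\<in>I. a i / c i * card {y \<in> V. R i y m})
      = (\<Sum>i\<in>I. a i / c i * (\<Sum>m\<in>V. card {y \<in> V. R i y m}))"
    by (subst sum.swap) (simp add: sum_distrib_left)
  also have "\<dots> = (\<Sum>i\<in>I. a i / c i * (\<Sum>y\<in>V. card {m \<in> V. R i y m}))"
    by (simp only: swap)
  also have "\<dots> \<le> (\<Sum>i\<in>I. a i / c i * (c i * card V))"
  proof (intro sum_mono mult_left_mono)
    fix i assume i: "i \<in> I"
    then have "(\<Sum>y\<in>V. real (card {m \<in> V. R i y m})) \<le> of_nat (card V) * c i"
      by (intro sum_bounded_above few)
    then show "real (\<Sum>y\<in>V. card {m \<in> V. R i y m}) \<le> c i * card V"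
      by (simp add: mult.commute)
    show "0 \<le> a i / c i" using pos[OF i] by simp
  qed
  also have "\<dots> = sum a I * card V"
    unfolding sum_distrib_right by (intro sum.cong refl) (use pos in \<open>force simp: field_simps\<close>)
  finally obtain m where m: "m \<in> V" "(\<Sum>i\<in>I. a i / c i * card {y \<in> V. R i y m}) \<le> sum a I"
    using ex_le_of_sum_le[OF \<open>finite V\<close> \<open>V \<noteq> {}\<close>] by blast
  have "card {y \<in> V. R i y m} \<le> sum a I / a i * c i" if i: "i \<in> I" for i
  proof -
    have "a i / c i * card {y \<in> V. R i y m} \<le> (\<Sum>i\<in>I. a i / c i * card {y \<in> V. R i y m})"
      using i \<open>finite I\<close> pos by (intro member_le_sum) (auto simp: less_imp_le)
    with m(2) have "a i / c i * card {y \<in> V. R i y m} \<le> sum a I" by linarith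
    with pos[OF i] show ?thesis by (simp add: field_simps)
  qed
  with m(1) show ?thesis by blast
qed

section \<open>Building the ordering from the top\<close>

lemma linear_order_on_insert_greatest:
  assumes "linear_order_on U \<sigma>" "m \<notin> U"
  shows "linear_order_on (insert m U) (\<sigma> \<union> insert m U \<times> {m})"
proof -
  have sub: "\<sigma> \<subseteq> U \<times> U" and r: "refl_on U \<sigma>" and t: "trans \<sigma>" and a: "antisym \<sigma>" and l: "total_on U \<sigma>"
    using assms(1) by (auto simp: order_on_defs)
  let ?\<tau> = "\<sigma> \<union> insert m U \<times> {m}"
  have "refl_on (insert m U) ?\<tau>" using r by (auto simp: refl_on_def)
  moreover have "trans ?\<tau>" using t sub assms(2) by (auto intro!: transI dest: transD)
  moreover have "antisym ?\<tau>" using a sub assms(2) by (auto intro!: antisymI dest: antisymD)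
  moreover have "total_on (insert m U) ?\<tau>" using l by (auto simp: total_on_def)
  ultimately show ?thesis using sub by (auto simp: order_on_defs)
qed

text \<open>Induction on \<open>V\<close>: a vertex \<open>m\<close> rarely related within
  \<open>V\<close> becomes the greatest one, above an ordering of \<open>V - {m}\<close>. The
  vertices below \<open>m\<close> are then exactly those among which \<open>m\<close> was
  chosen.\<close>

lemma ex_uniform_ordering:
  fixes R :: "'i \<Rightarrow> 'a \<Rightarrow> 'a \<Rightarrow> bool" and a c :: "'i \<Rightarrow> real"
  assumes "finite I" "finite V"
    and pos: "\<And>i. i \<in> I \<Longrightarrow> a i > 0" "\<And>i. i \<in> I \<Longrightarrow> c i > 0"
    and few: "\<And>i y. i \<in> I \<Longrightarrow> y \<in> V \<Longrightarrow> card {m \<in> V. R i y m} \<le> c i"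
  shows "\<exists>\<sigma>. linear_order_on V \<sigma> \<and>
    (\<forall>i\<in>I. \<forall>m\<in>V. card {y \<in> V. (y, m) \<in> \<sigma> \<and> R i y m} \<le> sum a I / a i * c i)"
  \<comment> \<open>As \<open>few\<close> depends on \<open>V\<close>, it is carried through the
    induction. It passes to subsets with the same \<open>c\<close>.\<close>
  using \<open>finite V\<close> few
proof (induction V rule: finite_psubset_induct)
  case (psubset V)
  show ?case
  proof (cases "V = {}")
    case True
    then show ?thesis by (intro exI[of _ "{}"]) simp
  next
    case False
    obtain m where m: "m \<in> V" "\<And>i. i \<in> I \<Longrightarrow> card {y \<in> V. R i y m} \<le> sum a I / a i * c i"
      using ex_uniformly_rarely_related[of I V a c R] \<open>finite I\<close> \<open>finite V\<close> False pos psubset.prems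
      by blast
    define U where "U = V - {m}"
    have V: "V = insert m U" and "m \<notin> U" using m(1) by (auto simp: U_def)
    have "card {z \<in> U. R i y z} \<le> c i" if "i \<in> I" "y \<in> U" for i y
    proof -
      have "card {z \<in> U. R i y z} \<le> card {z \<in> V. R i y z}"
        using \<open>finite V\<close> V by (intro card_mono) auto
      with psubset.prems[of i y] that V show ?thesis by fastforce
    qed
    moreover have "U \<subset> V" using V \<open>m \<notin> U\<close> by blast
    ultimately obtain \<sigma> where \<sigma>: "linear_order_on U \<sigma>"
      "\<And>i z. i \<in> I \<Longrightarrow> z \<in> U \<Longrightarrow> card {y \<in> U. (y, z) \<in> \<sigma> \<and> R i y z} \<le> sum a I / a i * c i"
      using psubset.IH[of U] by blast
    define \<tau> where "\<tau> = \<sigma> \<union> V \<times> {m}"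
    have sub: "\<sigma> \<subseteq> U \<times> U" using \<sigma>(1) by (simp add: order_on_defs)
    have "linear_order_on V \<tau>"
      using linear_order_on_insert_greatest[OF \<sigma>(1) \<open>m \<notin> U\<close>] by (simp add: \<tau>_def V)
    moreover have "card {y \<in> V. (y, z) \<in> \<tau> \<and> R i y z} \<le> sum a I / a i * c i"
      if "i \<in> I" "z \<in> V" for i z
    proof (cases "z = m")
      case True
      have "{y \<in> V. (y, m) \<in> \<tau> \<and> R i y m} = {y \<in> V. R i y m}" by (auto simp: \<tau>_def)
      with m(2) that True show ?thesis by simp
    next
      case False
      \<comment> \<open>Adding \<open>m\<close> on top puts nothing new below \<open>z\<close>, so
        earlier counts are unchanged.\<close>
      have "{y \<in> V. (y, z) \<in> \<tau> \<and> R i y z} = {y \<in> U. (y, z) \<in> \<sigma> \<and> R i y z}"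
        using False sub V by (auto simp: \<tau>_def)
      with \<sigma>(2)[of i z] that False V show ?thesis by auto
    qed
    ultimately show ?thesis by blast
  qed
qed

section \<open>Paths and reachability\<close>

lemma linear_order_on_ex_least:
  assumes "linear_order_on V \<sigma>" "finite S" "S \<noteq> {}" "S \<subseteq> V"
  shows "\<exists>m\<in>S. \<forall>p\<in>S. (m, p) \<in> \<sigma>"
  using assms(2-4)
proof (induction rule: finite_ne_induct)
  case (singleton x)
  then show ?case using assms(1) by (auto simp: order_on_defs refl_on_def)
next
  case (insert x F)
  then obtain m where m: "m \<in> F" "\<forall>p\<in>F. (m, p) \<in> \<sigma>" by auto
  have "(x, m) \<in> \<sigma> \<or> (m, x) \<in> \<sigma>" "(x, x) \<in> \<sigma>" "trans \<sigma>"
    using assms(1) insert m(1) by (auto simp: order_on_defs refl_on_def total_on_def)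
  with m show ?case by (auto dest: transD)
qed

lemma (in pair_graph) path_between_rev:
  assumes "path_between G x P y"
  shows "path_between G y (rev P) x"
proof -
  have P: "set P \<subseteq> pverts G" "set (vwalk_arcs P) \<subseteq> parcs G" "P \<noteq> []" "distinct P"
    "hd P = x" "last P = y"
    using assms by (auto simp: path_between_def vpath_def vwalk_def)
  have "set (vwalk_arcs (rev P)) \<subseteq> parcs G"
    using P(2) by (auto simp: set_vwalk_arcs_rev intro: arcs_symmetric)
  with P show ?thesis
    by (auto simp: path_between_def vpath_def vwalk_def hd_rev last_rev)
qed

lemma path_between_append_l:
  assumes "path_between G x (ys @ m # zs) y"
  shows "path_between G x (ys @ [m]) m"
proof -
  have "vwalk ((ys @ [m]) @ zs) (with_proj G)" "distinct (ys @ m # zs)" "hd (ys @ m # zs) = x"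
    using assms by (auto simp: path_between_def vpath_def)
  then show ?thesis
    using vwalkI_append_l[of "ys @ [m]" zs "with_proj G"]
    by (auto simp: path_between_def vpath_def hd_append)
qed

lemma path_between_append_r:
  assumes "path_between G x (ys @ m # zs) y"
  shows "path_between G m (m # zs) y"
  using assms vwalkI_append_r[of "m # zs" ys "with_proj G"]
  by (auto simp: path_between_def vpath_def)

text \<open>The initial segment of \<open>P\<close> ending at \<open>m\<close> is a witness: it is
  no longer than \<open>P\<close> and visits only vertices of \<open>P\<close>, all of them at least
  \<open>m\<close>.\<close>

lemma weakly_reachable_least:
  assumes "path_between G x P y" "vwalk_length P \<le> r" "m \<in> set P" "\<forall>p\<in>set P. (m, p) \<in> \<sigma>"
  shows "weakly_reachable r G \<sigma> x m"
proof -
  obtain ys zs where P: "P = ys @ m # zs" using assms(3) by (meson split_list)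
  have "path_between G x (ys @ [m]) m" using assms(1) path_between_append_l unfolding P by fast
  moreover have "x \<in> set P" using assms(1) by (auto simp: path_between_def vpath_def vwalk_def)
  ultimately show ?thesis
    using assms(2,4) unfolding weakly_reachable_def
    by (intro conjI exI[of _ "ys @ [m]"]) (auto simp: P)
qed

text \<open>One \<open>m\<close>, the \<open>\<tau>\<close>-least vertex of the path, serves both
  ends: the path is cut at \<open>m\<close> once as it stands and once reversed.\<close>

lemma (in pair_graph) strongly_reachable_imp:
  assumes lin: "linear_order_on (pverts G) \<tau>" and "r \<le> s" and "strongly_reachable r G \<sigma> x y"
  obtains m where "m \<in> W_set s G \<tau> x" "weakly_reachable s G \<tau> y m"
    "y = m \<or> (y, x) \<in> \<sigma> \<and> (x, m) \<in> \<sigma>"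
proof -
  obtain P where P: "path_between G x P y" "vwalk_length P \<le> r" "(y, x) \<in> \<sigma>"
    "\<forall>p\<in>set P - {y}. (x, p) \<in> \<sigma>"
    using assms(3) by (auto simp: strongly_reachable_def)
  have "set P \<subseteq> pverts G" "P \<noteq> []"
    using P(1) by (auto simp: path_between_def vpath_def vwalk_def)
  then obtain m where m: "m \<in> set P" "\<forall>p\<in>set P. (m, p) \<in> \<tau>" "m \<in> pverts G"
    using linear_order_on_ex_least[OF lin, of "set P"] by auto
  have "weakly_reachable s G \<tau> x m"
    using weakly_reachable_least[OF P(1) _ m(1,2)] P(2) \<open>r \<le> s\<close> by simp
  moreover have "weakly_reachable s G \<tau> y m"
    using weakly_reachable_least[OF path_between_rev[OF P(1)], of s m \<tau>] P(2) \<open>r \<le> s\<close> m by simp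
  \<comment> \<open>If \<open>m\<close> is not \<open>y\<close>, it lies in
    \<open>set P - {y}\<close>, where strong reachability gives
    \<open>(x, m) \<in> \<sigma>\<close>.\<close>
  ultimately show thesis using that[of m] m P by (auto simp: W_set_def)
qed

section \<open>Colouring numbers and the final count\<close>

lemma finite_linear_orders: "finite V \<Longrightarrow> finite {\<sigma>. linear_order_on V \<sigma>}"
  by (rule finite_subset[of _ "Pow (V \<times> V)"]) (auto simp: order_on_defs)

lemma wcol_attained:
  assumes "finite (pverts G)"
  shows "\<exists>\<sigma>. linear_order_on (pverts G) \<sigma> \<and>
    (\<forall>x\<in>pverts G. card (W_set r G \<sigma> x) \<le> wcol r G)"
proof -
  let ?L = "{\<sigma>. linear_order_on (pverts G) \<sigma>}"
  \<comment> \<open>The well-ordering theorem supplies a linear order, so the minimum ranges over a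
    nonempty set.\<close>
  have "?L \<noteq> {}" using well_order_on[of "pverts G"] by (auto simp: well_order_on_def)
  then have "wcol r G \<in> wcol_ord r G ` ?L"
    unfolding wcol_def using finite_linear_orders[OF assms] by (intro Min_in) auto
  then obtain \<sigma> where \<sigma>: "linear_order_on (pverts G) \<sigma>" "wcol r G = wcol_ord r G \<sigma>" by auto
  have "card (W_set r G \<sigma> x) \<le> wcol r G" if "x \<in> pverts G" for x
    unfolding \<sigma>(2) wcol_ord_def using assms that
    by (intro cSUP_upper bdd_above_finite) auto
  with \<sigma>(1) show ?thesis by blast
qed

text \<open>The witness is the one-vertex path. This makes \<open>wcol\<close> positive on nonempty
  graphs, so that the weights \<open>a i / c i\<close> are well defined.\<close>

lemma self_in_W_set:
  assumes "linear_order_on (pverts G) \<sigma>" "x \<in> pverts G"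
  shows "x \<in> W_set r G \<sigma> x"
proof -
  have "(x, x) \<in> \<sigma>" using assms by (auto simp: order_on_defs refl_on_def)
  moreover have "path_between G x [x] x"
    using assms(2) by (auto simp: path_between_def vpath_self)
  ultimately show ?thesis
    using assms(2) unfolding W_set_def weakly_reachable_def by (auto intro!: exI[of _ "[x]"])
qed

text \<open>The case \<open>y = m\<close> contributes \<open>W_set s G \<tau> x\<close> itself, of
  size at most \<open>c\<close>. Otherwise \<open>y \<le> x \<le> m\<close> in
  \<open>\<sigma>\<close>, and transitivity puts \<open>y\<close> in the set counted by
  \<open>b\<close> for one of at most \<open>c\<close> vertices \<open>m\<close>.\<close>

lemma (in pair_graph) card_S_set_le:
  assumes "linear_order_on (pverts G) \<tau>" "trans \<sigma>" "r \<le> s"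
    and c: "card (W_set s G \<tau> x) \<le> c"
    and b: "\<And>m. m \<in> pverts G \<Longrightarrow>
      real (card {y \<in> pverts G. (y, m) \<in> \<sigma> \<and> weakly_reachable s G \<tau> y m}) \<le> b"
    and "0 \<le> b"
  shows "real (card (S_set r G \<sigma> x)) \<le> real c * b + real c"
proof -
  let ?W = "W_set s G \<tau> x"
  let ?B = "\<lambda>m. {y \<in> pverts G. (y, m) \<in> \<sigma> \<and> weakly_reachable s G \<tau> y m}"
  have fin: "finite ?W" by (simp add: W_set_def)
  have "S_set r G \<sigma> x \<subseteq> ?W \<union> (\<Union>m\<in>?W. ?B m)"
  proof
    fix y assume "y \<in> S_set r G \<sigma> x"
    then have "y \<in> pverts G" "strongly_reachable r G \<sigma> x y" by (auto simp: S_set_def)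
    with strongly_reachable_imp[OF assms(1,3), of \<sigma> x y] \<open>trans \<sigma>\<close>
    show "y \<in> ?W \<union> (\<Union>m\<in>?W. ?B m)" by (blast dest: transD)
  qed
  then have "card (S_set r G \<sigma> x) \<le> card (?W \<union> (\<Union>m\<in>?W. ?B m))"
    using fin by (intro card_mono) auto
  also have "\<dots> \<le> card ?W + (\<Sum>m\<in>?W. card (?B m))"
    using card_UN_le[OF fin, of ?B] by (intro order_trans[OF card_Un_le]) simp
  finally have "real (card (S_set r G \<sigma> x)) \<le> card ?W + (\<Sum>m\<in>?W. real (card (?B m)))"
    by (simp flip: of_nat_sum of_nat_add)
  also have "(\<Sum>m\<in>?W. real (card (?B m))) \<le> card ?W * b"
    by (intro sum_bounded_above b) (simp add: W_set_def)
  also have "card ?W * b \<le> c * b" using c \<open>0 \<le> b\<close> by (intro mult_right_mono) auto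
  finally show ?thesis using c by simp
qed

theorem theorem4p1:
  fixes V :: "'a set" and k :: nat
    and G :: "nat \<Rightarrow> 'a pair_pre_digraph"
    and a r :: "nat \<Rightarrow> nat" and A :: nat
  assumes "finite V"
    and "\<And>i. i \<in> {1..k} \<Longrightarrow> pair_graph (G i)"
    and "\<And>i. i \<in> {1..k} \<Longrightarrow> pverts (G i) = V"
    and "\<And>i. i \<in> {1..k} \<Longrightarrow> a i > 0"
    and "\<And>i. i \<in> {1..k} \<Longrightarrow> r i > 0"
    and "A = (\<Sum>i=1..k. a i)"
  shows "\<exists>\<sigma>. linear_order_on V \<sigma> \<and>
    (\<forall>i\<in>{1..k}. real (scol_ord (r i) (G i) \<sigma>) \<le>
       real A / real (a i) * (real (wcol (2 * r i) (G i)))\<^sup>2 + real (wcol (2 * r i) (G i)))"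
proof (cases "V = {}")
  \<comment> \<open>Without vertices \<open>wcol\<close> need not be positive; here the empty
    relation serves, with \<open>scol_ord\<close> equal to \<open>Sup {} = 0\<close>.\<close>
  case True
  then show ?thesis
    using assms(3) by (intro exI[of _ "{}"]) (auto simp: scol_ord_def)
next
  case False
  let ?c = "\<lambda>i. wcol (2 * r i) (G i)"
  have "\<exists>\<tau>. linear_order_on V \<tau> \<and> (\<forall>x\<in>V. card (W_set (2 * r i) (G i) \<tau> x) \<le> ?c i)"
    if i: "i \<in> {1..k}" for i
    using wcol_attained[of "G i" "2 * r i"] assms(1) assms(3)[OF i] by simp
  then have "\<forall>i\<in>{1..k}. \<exists>\<tau>. linear_order_on V \<tau> \<and>
      (\<forall>x\<in>V. card (W_set (2 * r i) (G i) \<tau> x) \<le> ?c i)"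
    by blast
  from bchoice[OF this] obtain \<tau> where \<tau>: "\<And>i. i \<in> {1..k} \<Longrightarrow> linear_order_on V (\<tau> i)"
    "\<And>i x. i \<in> {1..k} \<Longrightarrow> x \<in> V \<Longrightarrow> card (W_set (2 * r i) (G i) (\<tau> i) x) \<le> ?c i"
    by blast
  let ?R = "\<lambda>i. weakly_reachable (2 * r i) (G i) (\<tau> i)"
  have few: "card {m \<in> V. ?R i y m} \<le> ?c i" if "i \<in> {1..k}" "y \<in> V" for i y
    using \<tau>(2)[OF that] assms(3)[OF that(1)] by (simp add: W_set_def)
  have pos: "?c i > 0" if i: "i \<in> {1..k}" for i
  proof -
    obtain x where x: "x \<in> V" using False by blast
    have "x \<in> W_set (2 * r i) (G i) (\<tau> i) x"
      using self_in_W_set[of "G i" "\<tau> i" x] \<tau>(1)[OF i] assms(3)[OF i] x by simp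
    moreover have "finite (W_set (2 * r i) (G i) (\<tau> i) x)"
      using assms(1) assms(3)[OF i] by (simp add: W_set_def)
    ultimately have "card (W_set (2 * r i) (G i) (\<tau> i) x) > 0" by (auto simp: card_gt_0_iff)
    with \<tau>(2)[OF i x] show ?thesis by simp
  qed
  have A: "real A = (\<Sum>i\<in>{1..k}. real (a i))" by (simp add: assms(6))
  obtain \<sigma> where \<sigma>: "linear_order_on V \<sigma>" "\<And>i m. i \<in> {1..k} \<Longrightarrow> m \<in> V \<Longrightarrow>
      real (card {y \<in> V. (y, m) \<in> \<sigma> \<and> ?R i y m}) \<le> real A / real (a i) * real (?c i)"
    using ex_uniform_ordering[of "{1..k}" V "\<lambda>i. real (a i)" "\<lambda>i. real (?c i)" ?R]
      assms(1,4) pos few unfolding A by auto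
  have "real (scol_ord (r i) (G i) \<sigma>) \<le> real A / real (a i) * (real (?c i))\<^sup>2 + real (?c i)"
    if i: "i \<in> {1..k}" for i
  proof -
    interpret pair_graph "G i" using assms(2)[OF i] .
    note [simp] = assms(3)[OF i]
    \<comment> \<open>On a finite nonempty \<open>V\<close> the supremum is attained, so bounding a
      single \<open>S_set\<close> is enough.\<close>
    have "scol_ord (r i) (G i) \<sigma> \<in> (\<lambda>x. card (S_set (r i) (G i) \<sigma> x)) ` V"
      using False \<open>finite V\<close> by (simp add: scol_ord_def cSup_eq_Max)
    then obtain x where x: "x \<in> V" "scol_ord (r i) (G i) \<sigma> = card (S_set (r i) (G i) \<sigma> x)"
      by blast
    have "trans \<sigma>" using \<sigma>(1) by (simp add: order_on_defs)
    \<comment> \<open>With \<open>b = A / a i * c\<close>, where \<open>c\<close> is the weak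
      colouring number, \<open>c * b\<close> is the quadratic term of the claim.\<close>
    then have "real (card (S_set (r i) (G i) \<sigma> x))
        \<le> real (?c i) * (real A / real (a i) * real (?c i)) + real (?c i)"
      using card_S_set_le[of "\<tau> i" \<sigma> "r i" "2 * r i" x "?c i" "real A / real (a i) * real (?c i)"]
        \<tau>[OF i] \<sigma>(2)[OF i] x(1) by simp
    with x(2) show ?thesis by (simp add: power2_eq_square mult_ac)
  qed
  with \<sigma>(1) show ?thesis by blast
qed

end
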